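(* There exists an absolute constant $C>0$ such that for every integer $n\ge 2$ and every prime $q$, the mixing time $t_{\mathrm{mix}}^{(n)}$ of the lazy upper triangular walk $\mathcal{W}_1$ on $G_n(q)$ satisfies $$t_{\mathrm{mix}}^{(n)}\leq C\,n^2\log q .$$
   Context: For $n\ge 2$ and $q$ prime, $G_n(q)$ is the group (under multiplication) of $n\times n$ upper triangular matrices with entries in the field $\mathbb{Z}_q$ and $1$'s along the diagonal. The lazy upper triangular walk $\mathcal{W}_1$ on $G_n(q)$ is the discrete-time Markov chain in which each step chooses independently a uniformly random $i\in\{1,\dots,n-1\}$ and a uniformly random $a\in\mathbb{Z}_q$, and adds $a$ times row $i+1$ to row $i$; that is, the current matrix $X$ is replaced by $(I+aE_{i,i+1})X$, where $E_{i,j}$ is the $n\times n$ matrix with $1$ at position $(i,j)$ and $0$ elsewhere. (The step $a=0$, of probability $1/q$, leaves the matrix unchanged.) This chain is ergodic and reversible with respect to the uniform distribution on $G_n(q)$. The total variation distance between probability measures $\nu_1,\nu_2$ on a countable set $\Omega$ is $\|\nu_1-\nu_2\|_{TV}=\max_{A\subset\Omega}|\nu_1(A)-\nu_2(A)|=\frac12\sum_{x\in\Omega}|\nu_1(x)-\nu_2(x)|$. For an ergodic Markov chain $Y_t$ with state space $\Omega$ and stationary distribution $\nu$, the mixing time is $t_{\mathrm{mix}}=\inf\{t:\max_{y\in\Omega}\|\mathbb{P}_y(Y_t\in\cdot)-\nu\|_{TV}<\frac{1}{2e}\}$, where $\mathbb{P}_y$ is the law of the chain started at $y$ (and $t$ ranges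 over nonnegative integers in discrete time). $t_{\mathrm{mix}}^{(n)}$ denotes the mixing time of $\mathcal{W}_1$ on $G_n(q)$. *)

theory Defs
  imports
    "HOL-Probability.Probability"
    "HOL-Algebra.Group"
    "Jordan_Normal_Form.Determinant"
begin

section \<open>Total variation distance and mixing time\<close>

text \<open>Both suprema below are over nonempty sets of reals in the interval from 0 to 1; for a
  finite state space they are maxima.\<close>

definition tv_dist :: "'a set \<Rightarrow> 'a pmf \<Rightarrow> 'a pmf \<Rightarrow> real" where
  "tv_dist \<Omega> \<nu>1 \<nu>2 =
     (SUP A\<in>Pow \<Omega>. \<bar>measure_pmf.prob \<nu>1 A - measure_pmf.prob \<nu>2 A\<bar>)"

primrec chain_law :: "('a \<Rightarrow> 'a pmf) \<Rightarrow> 'a \<Rightarrow> nat \<Rightarrow> 'a pmf" where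
  "chain_law K y 0 = return_pmf y"
| "chain_law K y (Suc t) = bind_pmf (chain_law K y t) K"

text \<open>The infimum is taken in \<^typ>\<open>enat\<close>, so that it is infinite (and not 0) if no time qualifies.\<close>

definition mixing_time :: "'a set \<Rightarrow> ('a \<Rightarrow> 'a pmf) \<Rightarrow> 'a pmf \<Rightarrow> enat" where
  "mixing_time \<Omega> K \<nu> =
     Inf (enat ` {t. (SUP y\<in>\<Omega>. tv_dist \<Omega> (chain_law K y t) \<nu>) < 1 / (2 * exp 1)})"


section \<open>The group of unit upper triangular matrices over the integers modulo q\<close>

text \<open>The field with \<open>q\<close> elements is represented by the residues \<open>{0..<q}\<close> with
  arithmetic modulo \<open>q\<close>, since \<open>q\<close> is quantified inside the statement and cannot be
  encoded in a type. Rows and columns are numbered from 0.\<close>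

definition mod_mat :: "nat \<Rightarrow> int mat \<Rightarrow> int mat" where
  "mod_mat q A = map_mat (\<lambda>x. x mod int q) A"

definition unitri :: "nat \<Rightarrow> nat \<Rightarrow> int mat set" where
  "unitri n q = {A \<in> carrier_mat n n. upper_triangular A \<and> (\<forall>i<n. A $$ (i, i) = 1) \<and>
     (\<forall>i<n. \<forall>j<n. A $$ (i, j) \<in> {0..<int q})}"

definition unitri_group :: "nat \<Rightarrow> nat \<Rightarrow> int mat monoid" where
  "unitri_group n q =
     \<lparr>carrier = unitri n q, mult = (\<lambda>A B. mod_mat q (A * B)), one = 1\<^sub>m n\<rparr>"


section \<open>The lazy upper triangular walk\<close>

text \<open>\<^term>\<open>addrow_mat n a i (Suc i)\<close> is the identity matrix plus \<open>a\<close> times the matrix unit at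
  \<open>(i, i + 1)\<close>.\<close>

definition lazy_walk :: "nat \<Rightarrow> nat \<Rightarrow> int mat \<Rightarrow> int mat pmf" where
  "lazy_walk n q X =
     do {
       i \<leftarrow> pmf_of_set {0..<n - 1};
       a \<leftarrow> pmf_of_set {0..<int q};
       return_pmf (addrow_mat n a i (Suc i) \<otimes>\<^bsub>unitri_group n q\<^esub> X)
     }"

definition lazy_walk_mixing_time :: "nat \<Rightarrow> nat \<Rightarrow> enat" where
  "lazy_walk_mixing_time n q =
     mixing_time (carrier (unitri_group n q)) (lazy_walk n q)
       (pmf_of_set (carrier (unitri_group n q)))"


section \<open>Basic facts: group laws and stationarity of the uniform distribution\<close>

lemma unitri_iff:
  "A \<in> unitri n q \<longleftrightarrow> A \<in> carrier_mat n n \<and> (\<forall>i<n. \<forall>j<i. A $$ (i, j) = 0) \<and>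
     (\<forall>i<n. A $$ (i, i) = 1) \<and> (\<forall>i<n. \<forall>j<n. 0 \<le> A $$ (i, j) \<and> A $$ (i, j) < int q)"
  by (auto simp: unitri_def upper_triangular_def)

lemma mod_mat_carrier [simp]: "mod_mat q A \<in> carrier_mat n m \<longleftrightarrow> A \<in> carrier_mat n m"
  by (simp add: mod_mat_def)

lemma mod_mat_index:
  "A \<in> carrier_mat n m \<Longrightarrow> i < n \<Longrightarrow> j < m \<Longrightarrow> mod_mat q A $$ (i, j) = A $$ (i, j) mod int q"
  by (auto simp: mod_mat_def)

lemma mod_mat_unitri: "A \<in> unitri n q \<Longrightarrow> mod_mat q A = A"
  by (rule eq_matI) (auto simp: unitri_iff mod_mat_def)

lemma mat_mult_index:
  "A \<in> carrier_mat n n \<Longrightarrow> B \<in> carrier_mat n n \<Longrightarrow> i < n \<Longrightarrow> j < n \<Longrightarrow>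
     (A * B) $$ (i, j) = (\<Sum>k = 0..<n. A $$ (i, k) * B $$ (k, j) :: int)"
  by (auto simp: scalar_prod_def intro!: sum.cong)

lemma mod_mat_mult_left:
  assumes "A \<in> carrier_mat n n" "B \<in> carrier_mat n n"
  shows "mod_mat q (mod_mat q A * B) = mod_mat q (A * B)"
proof (rule eq_matI)
  fix i j assume "i < dim_row (mod_mat q (A * B))" "j < dim_col (mod_mat q (A * B))"
  then have ij: "i < n" "j < n" using assms by (auto simp: mod_mat_def)
  have "(\<Sum>k = 0..<n. A $$ (i, k) mod int q * B $$ (k, j)) mod int q =
        (\<Sum>k = 0..<n. A $$ (i, k) * B $$ (k, j)) mod int q"
    using mod_sum_eq [of "\<lambda>k. A $$ (i, k) mod int q * B $$ (k, j)" "int q" "{0..<n}"]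
      mod_sum_eq [of "\<lambda>k. A $$ (i, k) * B $$ (k, j)" "int q" "{0..<n}"]
    unfolding mod_mult_left_eq by (rule trans [OF sym])
  then show "mod_mat q (mod_mat q A * B) $$ (i, j) = mod_mat q (A * B) $$ (i, j)"
    using assms ij
    by (simp add: mod_mat_index [where n = n and m = n] mat_mult_index [where n = n]
        del: index_mult_mat)
qed (use assms in \<open>auto simp: mod_mat_def\<close>)

lemma mod_mat_mult_right:
  assumes "A \<in> carrier_mat n n" "B \<in> carrier_mat n n"
  shows "mod_mat q (A * mod_mat q B) = mod_mat q (A * B)"
proof (rule eq_matI)
  fix i j assume "i < dim_row (mod_mat q (A * B))" "j < dim_col (mod_mat q (A * B))"
  then have ij: "i < n" "j < n" using assms by (auto simp: mod_mat_def)
  have "(\<Sum>k = 0..<n. A $$ (i, k) * (B $$ (k, j) mod int q)) mod int q =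
        (\<Sum>k = 0..<n. A $$ (i, k) * B $$ (k, j)) mod int q"
    using mod_sum_eq [of "\<lambda>k. A $$ (i, k) * (B $$ (k, j) mod int q)" "int q" "{0..<n}"]
      mod_sum_eq [of "\<lambda>k. A $$ (i, k) * B $$ (k, j)" "int q" "{0..<n}"]
    unfolding mod_mult_right_eq by (rule trans [OF sym])
  then show "mod_mat q (A * mod_mat q B) $$ (i, j) = mod_mat q (A * B) $$ (i, j)"
    using assms ij
    by (simp add: mod_mat_index [where n = n and m = n] mat_mult_index [where n = n]
        del: index_mult_mat)
qed (use assms in \<open>auto simp: mod_mat_def\<close>)

lemma unitri_mult_closed:
  assumes q: "q \<ge> 2" and A: "A \<in> unitri n q" and B: "B \<in> unitri n q"
  shows "mod_mat q (A * B) \<in> unitri n q"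
proof -
  have cA: "A \<in> carrier_mat n n" and cB: "B \<in> carrier_mat n n"
    using A B by (auto simp: unitri_iff)
  then have cAB: "A * B \<in> carrier_mat n n" by simp
  have low: "(A * B) $$ (i, j) = 0" if "i < n" "j < i" for i j
  proof -
    have "A $$ (i, k) * B $$ (k, j) = 0" if "k < n" for k
      using A B \<open>i < n\<close> \<open>j < i\<close> that by (cases "k < i") (auto simp: unitri_iff)
    then have "(\<Sum>k = 0..<n. A $$ (i, k) * B $$ (k, j)) = 0"
      by (intro sum.neutral) simp
    then show ?thesis using mat_mult_index [OF cA cB] that by simp
  qed
  have diag: "(A * B) $$ (i, i) = 1" if "i < n" for i
  proof -
    have "A $$ (i, k) * B $$ (k, i) = (if k = i then 1 else 0)" if "k < n" for k
      using A B \<open>i < n\<close> that by (cases k i rule: linorder_cases) (auto simp: unitri_iff)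
    then have "(\<Sum>k = 0..<n. A $$ (i, k) * B $$ (k, i)) = 1"
      using that by simp
    then show ?thesis using mat_mult_index [OF cA cB that that] by simp
  qed
  show ?thesis
    using q cAB low diag
    by (simp add: unitri_iff mod_mat_index [OF cAB] del: index_mult_mat)
qed

lemma one_unitri: "q \<ge> 2 \<Longrightarrow> 1\<^sub>m n \<in> unitri n q"
  by (auto simp: unitri_iff)

lemma finite_unitri: "finite (unitri n q)"
proof (rule finite_subset)
  show "unitri n q \<subseteq> (\<lambda>f. mat n n f) ` (({..<n} \<times> {..<n}) \<rightarrow>\<^sub>E {0..<int q})"
  proof
    fix A assume A: "A \<in> unitri n q"
    have "A = mat n n (restrict (($$) A) ({..<n} \<times> {..<n}))"
      using A by (intro eq_matI) (auto simp: unitri_iff)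
    moreover have "restrict (($$) A) ({..<n} \<times> {..<n}) \<in> ({..<n} \<times> {..<n}) \<rightarrow>\<^sub>E {0..<int q}"
      using A by (auto simp: unitri_iff)
    ultimately show "A \<in> (\<lambda>f. mat n n f) ` (({..<n} \<times> {..<n}) \<rightarrow>\<^sub>E {0..<int q})"
      by blast
  qed
qed (intro finite_imageI finite_PiE; simp)

lemma unitri_right_cancel:
  assumes A: "A \<in> unitri n q" and B: "B \<in> unitri n q" and C: "C \<in> unitri n q"
    and eq: "mod_mat q (B * A) = mod_mat q (C * A)"
  shows "B = C"
proof -
  have c: "A \<in> carrier_mat n n" "B \<in> carrier_mat n n" "C \<in> carrier_mat n n"
    using A B C by (auto simp: unitri_iff)
  have "upper_triangular A" using A by (simp add: unitri_def)
  then have "det A = prod_list (diag_mat A)" using c by (intro det_upper_triangular)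
  also have "\<dots> = 1"
    using A c by (auto simp: prod_list_diag_prod unitri_iff intro!: prod.neutral)
  finally have inv: "A * adj_mat A = 1\<^sub>m n" and c': "adj_mat A \<in> carrier_mat n n"
    using adj_mat [OF c(1)] by auto
  have *: "mod_mat q (mod_mat q (D * A) * adj_mat A) = D" if D: "D \<in> unitri n q" for D
  proof -
    have cD: "D \<in> carrier_mat n n" using D by (simp add: unitri_iff)
    have "mod_mat q (mod_mat q (D * A) * adj_mat A) = mod_mat q (D * A * adj_mat A)"
      using cD c(1) c' by (intro mod_mat_mult_left) auto
    also have "D * A * adj_mat A = D"
      using assoc_mult_mat [OF cD c(1) c'] inv cD by simp
    also have "mod_mat q D = D" using D by (rule mod_mat_unitri)
    finally show ?thesis .
  qed
  show ?thesis using * [OF B] * [OF C] unfolding eq by (rule trans [OF sym])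
qed

lemma unitri_group:
  assumes q: "q \<ge> 2"
  shows "group (unitri_group n q)"
proof (rule groupI)
  fix A assume "A \<in> carrier (unitri_group n q)"
  then have A: "A \<in> unitri n q" by (simp add: unitri_group_def)
  then have cA: "A \<in> carrier_mat n n" by (simp add: unitri_iff)
  show "\<one>\<^bsub>unitri_group n q\<^esub> \<otimes>\<^bsub>unitri_group n q\<^esub> A = A"
    using A cA by (simp add: unitri_group_def mod_mat_unitri)
  let ?f = "\<lambda>B. mod_mat q (B * A)"
  have "inj_on ?f (unitri n q)"
    using unitri_right_cancel [OF A] by (auto simp: inj_on_def)
  moreover have "?f ` unitri n q \<subseteq> unitri n q"
    using unitri_mult_closed [OF q] A by auto
  ultimately have "?f ` unitri n q = unitri n q"
    by (simp add: finite_unitri endo_inj_surj)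
  then have "1\<^sub>m n \<in> ?f ` unitri n q" using one_unitri [OF q] by simp
  then obtain B where "B \<in> unitri n q" "mod_mat q (B * A) = 1\<^sub>m n" by auto
  then show "\<exists>B\<in>carrier (unitri_group n q).
      B \<otimes>\<^bsub>unitri_group n q\<^esub> A = \<one>\<^bsub>unitri_group n q\<^esub>"
    by (auto simp: unitri_group_def)
next
  fix A B C
  assume "A \<in> carrier (unitri_group n q)" "B \<in> carrier (unitri_group n q)"
    "C \<in> carrier (unitri_group n q)"
  then have c: "A \<in> carrier_mat n n" "B \<in> carrier_mat n n" "C \<in> carrier_mat n n"
    by (auto simp: unitri_group_def unitri_iff)
  then have "mod_mat q (mod_mat q (A * B) * C) = mod_mat q (A * mod_mat q (B * C))"
    by (simp add: mod_mat_mult_left [where n = n] mod_mat_mult_right [where n = n])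
  then show "A \<otimes>\<^bsub>unitri_group n q\<^esub> B \<otimes>\<^bsub>unitri_group n q\<^esub> C =
      A \<otimes>\<^bsub>unitri_group n q\<^esub> (B \<otimes>\<^bsub>unitri_group n q\<^esub> C)"
    by (simp add: unitri_group_def)
qed (use unitri_mult_closed [OF q] one_unitri [OF q] in \<open>auto simp: unitri_group_def\<close>)

lemma addrow_mat_unitri:
  assumes "q \<ge> 2" "a \<in> {0..<int q}"
  shows "addrow_mat n a i (Suc i) \<in> unitri n q"
  using assms by (auto simp: unitri_iff)

lemma lazy_walk_stationary:
  assumes n: "n \<ge> 2" and q: "q \<ge> 2"
  shows "bind_pmf (pmf_of_set (carrier (unitri_group n q))) (lazy_walk n q) =
    pmf_of_set (carrier (unitri_group n q))"
proof -
  interpret group "unitri_group n q" using q by (rule unitri_group)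
  let ?G = "unitri_group n q" and ?S = "pmf_of_set {0..<int q}" and ?R = "pmf_of_set {0..<n - 1}"
  let ?U = "pmf_of_set (carrier ?G)"
  have fin: "finite (carrier ?G)" by (simp add: unitri_group_def finite_unitri)
  have ne: "carrier ?G \<noteq> {}" by blast
  have shift: "map_pmf (\<lambda>X. g \<otimes>\<^bsub>?G\<^esub> X) ?U = ?U" if g: "g \<in> carrier ?G" for g
  proof (rule map_pmf_of_set_bij_betw)
    have inj: "inj_on (\<lambda>X. g \<otimes>\<^bsub>?G\<^esub> X) (carrier ?G)"
      using g by (auto simp: inj_on_def)
    moreover have "(\<lambda>X. g \<otimes>\<^bsub>?G\<^esub> X) ` carrier ?G \<subseteq> carrier ?G" using g by auto
    ultimately show "bij_betw (\<lambda>X. g \<otimes>\<^bsub>?G\<^esub> X) (carrier ?G) (carrier ?G)"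
      using fin by (simp add: bij_betw_def endo_inj_surj)
  qed (use fin ne in auto)
  have "bind_pmf ?U (lazy_walk n q) =
      bind_pmf ?R (\<lambda>i. bind_pmf ?S (\<lambda>a. map_pmf (\<lambda>X. addrow_mat n a i (Suc i) \<otimes>\<^bsub>?G\<^esub> X) ?U))"
    unfolding lazy_walk_def map_pmf_def
    by (subst bind_commute_pmf, subst bind_commute_pmf [of ?U ?S]) (rule refl)
  also have "\<dots> = bind_pmf ?R (\<lambda>i. bind_pmf ?S (\<lambda>a. ?U))"
  proof (intro bind_pmf_cong refl shift)
    fix i a assume "a \<in> set_pmf ?S"
    then have "a \<in> {0..<int q}" using q by (subst (asm) set_pmf_of_set) auto
    then show "addrow_mat n a i (Suc i) \<in> carrier ?G"
      using addrow_mat_unitri [OF q] by (simp add: unitri_group_def)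
  qed
  also have "\<dots> = ?U" by simp
  finally show ?thesis .
qed

end

theory Submission
  imports Defs
begin

text \<open>The columns are averaged out one at a time, starting with the last. Call \<open>v\<close> the
  part of column \<open>j\<close> above the diagonal, \<open>\<chi>\<close> the additive character
  \<open>exp (2 \<pi> i k / q)\<close>, and \<open>\<theta>\<close> a bounded function of the columns to the left of \<open>j\<close>.
  Pulling the last step of the walk back to the test function \<open>\<theta> \<chi>(y \<bullet> v)\<close> changes \<open>\<theta>\<close> harmlessly
  and replaces the row vector \<open>y\<close> by \<open>y (I + a E\<^sub>i\<^sub>,\<^sub>i\<^sub>+\<^sub>1)\<close>: the nonzero positions of \<open>y\<close> perform an
  East process, in which a nonzero entry re-randomizes its right neighbour. The steps with
  \<open>i = j - 1\<close> (rows numbered from 0) multiply the function by \<open>\<chi>(a y\<^sub>j\<^sub>-\<^sub>1)\<close>, so they kill it on average if the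
  last entry of \<open>y\<close> is nonzero. The rightmost nonzero entry drifts to the right, so an
  exponential weight of its position is a strict supersolution of the killed process, and
  \<open>E (\<theta> \<chi>(y \<bullet> v))\<close> decays like \<open>2\<^sup>n (1 - c / n)\<^sup>t\<close>. After order \<open>n\<^sup>2 log q\<close> steps this beats
  the number of vectors \<open>y\<close>, and Fourier inversion in \<open>v\<close> replaces column \<open>j\<close> by a uniform one.\<close>

section \<open>The killed East process\<close>

text \<open>\<open>S\<close> stands for the set of nonzero positions of \<open>y\<close>. Truncated
  subtraction keeps the exponent between 0 and \<open>j\<close> whatever \<open>Max S\<close> is, so
  the two global bounds below need no nonemptiness.\<close>

definition front_weight :: "nat \<Rightarrow> nat set \<Rightarrow> real" where
  "front_weight j S =
     (10/9) ^ (j - 1 - Max S) * (if \<exists>r\<in>S. Suc r = Max S then 103/100 else 1)"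

lemma front_weight_Max:
  assumes "finite S" "x \<in> S" "\<And>r. r \<in> S \<Longrightarrow> r \<le> x"
  shows "front_weight j S = (10/9) ^ (j - 1 - x) * (if \<exists>r\<in>S. Suc r = x then 103/100 else 1)"
  using Max_eqI[of S x] assms by (simp add: front_weight_def)

text \<open>Lets the weight dominate a test function of norm at most 1 at time 0.\<close>

lemma front_weight_ge_1: "front_weight j S \<ge> 1"
proof -
  have "1 * 1 \<le> (10/9::real) ^ (j - 1 - Max S) * (if \<exists>r\<in>S. Suc r = Max S then 103/100 else 1)"
    using one_le_power[of "10/9::real"] by (intro mult_mono) auto
  then show ?thesis by (simp add: front_weight_def)
qed

lemma front_weight_le: "front_weight j S \<le> 2 * (10/9) ^ j"
proof -
  have "(10/9::real) ^ (j - 1 - Max S) \<le> (10/9) ^ j"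
    by (rule power_increasing) auto
  then have "(10/9::real) ^ (j - 1 - Max S) * (if \<exists>r\<in>S. Suc r = Max S then 103/100 else 1)
      \<le> (10/9) ^ j * 2"
    by (intro mult_mono) auto
  then show ?thesis by (simp add: front_weight_def)
qed

text \<open>The front \<open>Max S\<close> moves right at rate \<open>1 - s\<close>, and left at rate \<open>s\<close> if the site behind it
  is occupied, so at \<open>s = 1/2\<close> the position alone can have zero drift. The corrector \<open>103/100\<close> repairs
  this: if the site two behind is occupied, the site behind gets vacated at rate \<open>s\<close>, and otherwise
  a left move ends with an empty site behind the front.\<close>

lemma front_weight_drift:
  fixes s :: real
  assumes S: "S \<subseteq> {..<j}" "S \<noteq> {}" and s: "0 \<le> s" "s \<le> 1/2"
  shows "(\<Sum>i<j - 1. if i \<in> S then (1 - s) * front_weight j (insert (Suc i) S)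
                                 + s * front_weight j (S - {Suc i}) else front_weight j S)
     + (if j - 1 \<in> S then 0 else front_weight j S) \<le> (real j - 1/200) * front_weight j S"
    (is "(\<Sum>i<j - 1. ?R i) + ?kill \<le> _")
proof -
  have fin: "finite S" using S finite_subset by blast
  define x where "x = Max S"
  have x: "x \<in> S" "\<And>r. r \<in> S \<Longrightarrow> r \<le> x" using fin S by (auto simp: x_def)
  have xj: "x < j" using x S by auto
  define P :: real where "P = (10/9) ^ (j - 1 - x)"
  have P: "P > 0" by (simp add: P_def)
  define A where "A \<longleftrightarrow> (\<exists>r\<in>S. Suc r = x)"
  define B where "B \<longleftrightarrow> (\<exists>r\<in>S. Suc (Suc r) = x)"
  define w :: real where "w = (if A then 103/100 else 1)"
  define wB :: real where "wB = (if B then 103/100 else 1)"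
  have h: "front_weight j S = P * w"
    using front_weight_Max[OF fin x] by (simp add: P_def w_def A_def)
  \<comment> \<open>The changes of weight caused by the three relevant sites:
    \<open>\<alpha>\<close> when the front itself tries to push one site ahead,
    \<open>\<beta>\<close> when its left neighbour may erase it, \<open>\<gamma>\<close> when the
    site behind the front is refreshed from two behind.\<close>
  define \<alpha> where "\<alpha> = (1 - s) * (9/10 * (103/100) - w) * P"
  define \<beta> where "\<beta> = (if A then s * (10/9 * wB - w) * P else 0)"
  define \<gamma> where "\<gamma> = (if B then ((1 - s) * (103/100) + s - w) * P else 0)"
  \<comment> \<open>An update at \<open>i\<close> alters only site \<open>i + 1\<close>, and only if
    \<open>i\<close> is occupied. Below \<open>x - 2\<close> it touches neither the front nor the
    site behind it, and beyond \<open>x\<close> all sites are empty.\<close>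
  have R: "?R i = P * w + ((if i = x then \<alpha> else 0) + (if Suc i = x then \<beta> else 0)
      + (if Suc (Suc i) = x then \<gamma> else 0))" if i: "i < j - 1" for i
  proof (cases "i \<in> S")
    case False
    then have "i \<noteq> x" "Suc i = x \<Longrightarrow> \<not> A" "Suc (Suc i) = x \<Longrightarrow> \<not> B" 
      using x by (auto simp: A_def B_def)
    then show ?thesis using False by (auto simp: h \<beta>_def \<gamma>_def)
  next
    case iS: True
    consider "i = x" | "Suc i = x" | "Suc (Suc i) = x" | "Suc (Suc i) < x"
      using x(2)[OF iS] by linarith
    then show ?thesis
    proof cases
      case 1
      have "front_weight j (insert (Suc i) S) = (10/9) ^ (j - 1 - Suc x) * (103/100)"
        using fin x 1 by (subst front_weight_Max[where x = "Suc x"]) (auto simp: le_Suc_eq)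
      also have "(10/9::real) ^ (j - 1 - Suc x) = 9/10 * P"
      proof -
        have "j - 1 - x = Suc (j - 1 - Suc x)" using i 1 by simp
        then show ?thesis by (simp add: P_def)
      qed
      finally have 2: "front_weight j (insert (Suc i) S) = 9/10 * P * (103/100)" .
      have 3: "S - {Suc i} = S" using 1 x(2)[of "Suc x"] by auto
      show ?thesis using 1 iS unfolding 2 3 h \<alpha>_def by (simp add: algebra_simps)
    next
      case 2
      then have A using iS by (auto simp: A_def)
      have "front_weight j (S - {Suc i}) =
        (10/9) ^ (j - 1 - i) * (if \<exists>r\<in>S - {Suc i}. Suc r = i then 103/100 else 1)"
        using fin x(2) 2 iS by (intro front_weight_Max) (fastforce simp: le_Suc_eq)+
      also have "(if \<exists>r\<in>S - {Suc i}. Suc r = i then 103/100 else 1) = wB"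
        using 2 by (auto simp: wB_def B_def)
      also have "(10/9::real) ^ (j - 1 - i) = 10/9 * P"
      proof -
        have "j - 1 - i = Suc (j - 1 - x)" using xj 2 by simp
        then show ?thesis by (simp add: P_def)
      qed
      finally have 3: "front_weight j (S - {Suc i}) = 10/9 * P * wB" .
      have 4: "insert (Suc i) S = S" using 2 x by auto
      show ?thesis using 2 iS \<open>A\<close> unfolding 3 4 h \<beta>_def by (simp add: algebra_simps)
    next
      case 3
      then have B using iS by (auto simp: B_def)
      have 4: "front_weight j (insert (Suc i) S) = P * (103/100)"
        using fin x 3 by (subst front_weight_Max[where x = x]) (auto simp: P_def)
      have 5: "front_weight j (S - {Suc i}) = P"
        using fin x 3 by (subst front_weight_Max[where x = x]) (auto simp: P_def)
      show ?thesis using 3 iS \<open>B\<close> unfolding 4 5 h \<gamma>_def by (simp add: algebra_simps)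
    next
      case 4
      have 5: "front_weight j (insert (Suc i) S) = P * w"
        using fin x 4 by (subst front_weight_Max[where x = x]) (auto simp: P_def w_def A_def)
      have 6: "front_weight j (S - {Suc i}) = P * w"
        using fin x 4 by (subst front_weight_Max[where x = x]) (auto simp: P_def w_def A_def)
      show ?thesis using 4 iS unfolding 5 6 h by (simp add: algebra_simps)
    qed
  qed
  \<comment> \<open>Guards the natural subtractions \<open>x - 1\<close> and \<open>x - 2\<close>
    that pick out the single nonzero summand.\<close>
  have b: "\<beta> \<noteq> 0 \<Longrightarrow> x \<ge> 1" and g: "\<gamma> \<noteq> 0 \<Longrightarrow> x \<ge> 2"
    by (auto simp: \<beta>_def \<gamma>_def A_def B_def split: if_splits)
  have sb: "(\<Sum>i<j - 1. if Suc i = x then \<beta> else 0) = \<beta>"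
  proof (cases "\<beta> = 0")
    case False
    then have "(\<Sum>i<j - 1. if Suc i = x then \<beta> else 0) = (\<Sum>i<j - 1. if i = x - 1 then \<beta> else 0)"
      using b by (intro sum.cong) auto
    then show ?thesis using b False xj by simp
  qed (simp cong: if_cong)
  have sg: "(\<Sum>i<j - 1. if Suc (Suc i) = x then \<gamma> else 0) = \<gamma>"
  proof (cases "\<gamma> = 0")
    case False
    then have "(\<Sum>i<j - 1. if Suc (Suc i) = x then \<gamma> else 0) = (\<Sum>i<j - 1. if i = x - 2 then \<gamma> else 0)"
      using g by (intro sum.cong) auto
    then show ?thesis using g False xj by simp
  qed (simp cong: if_cong)
  have "(\<Sum>i<j - 1. ?R i) = (\<Sum>i<j - 1. P * w + ((if i = x then \<alpha> else 0)
      + (if Suc i = x then \<beta> else 0) + (if Suc (Suc i) = x then \<gamma> else 0)))"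
    using R by (intro sum.cong) auto
  also have "\<dots> = real (j - 1) * (P * w) + ((if x < j - 1 then \<alpha> else 0) + \<beta> + \<gamma>)"
    unfolding sum.distrib sb sg by simp
  finally have sumR: "(\<Sum>i<j - 1. ?R i) =
    (real j - 1) * (P * w) + ((if x < j - 1 then \<alpha> else 0) + \<beta> + \<gamma>)"
    using xj by (simp add: of_nat_diff)
  have "(if x < j - 1 then \<alpha> else 0) + \<beta> + \<gamma> + (if x = j - 1 then - (P * w) else 0)
      = P * ((if x < j - 1 then (1 - s) * (9/10 * (103/100) - w) else - w)
         + (if A then s * (10/9 * wB - w) else 0)
         + (if B then (1 - s) * (103/100) + s - w else 0))"
    using xj by (auto simp: \<alpha>_def \<beta>_def \<gamma>_def algebra_simps)
  also have "\<dots> \<le> P * (- 1/200 * w)"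
  proof (intro mult_left_mono)
    \<comment> \<open>Every case is affine in \<open>s\<close>, so the endpoints 0 and 1/2 decide.
      The tightest one is \<open>A\<close>, \<open>B\<close>, \<open>x < j - 1\<close> at
      \<open>s = 1/2\<close>: about -0.0093 on the left against -0.00515 on the right.\<close>
    show "(if x < j - 1 then (1 - s) * (9/10 * (103/100) - w) else - w)
         + (if A then s * (10/9 * wB - w) else 0)
         + (if B then (1 - s) * (103/100) + s - w else 0) \<le> - 1/200 * w"
      using s unfolding w_def wB_def
      by (cases A; cases B; cases "x < j - 1") (simp_all add: algebra_simps diff_divide_distrib)
  qed (use P in simp)
  finally have "(if x < j - 1 then \<alpha> else 0) + \<beta> + \<gamma> + (if x = j - 1 then - (P * w) else 0)
      \<le> - 1/200 * (P * w)" by simp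
  \<comment> \<open>As \<open>x\<close> is the maximum of \<open>S\<close> and lies below
    \<open>j\<close>, site \<open>j - 1\<close> is occupied exactly when it is the front.\<close>
  moreover have "?kill = P * w + (if x = j - 1 then - (P * w) else 0)"
    using x(1) x(2)[of "j - 1"] xj by (auto simp: h)
  ultimately have "?kill + (if x < j - 1 then \<alpha> else 0) + \<beta> + \<gamma> \<le> (1 - 1/200) * (P * w)"
    by simp
  then show ?thesis
    unfolding sumR unfolding h left_diff_distrib by linarith
qed

section \<open>Characters modulo \<open>q\<close>\<close>

definition chi :: "nat \<Rightarrow> int \<Rightarrow> complex" where
  "chi q k = cis (2 * pi * real_of_int k / real q)"

lemma chi_add: "chi q (k + l) = chi q k * chi q l"
  by (simp add: chi_def cis_mult add_divide_distrib ring_distribs)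

lemma chi_sum: "finite A \<Longrightarrow> chi q (\<Sum>i\<in>A. f i) = (\<Prod>i\<in>A. chi q (f i))"
  by (induction A rule: finite_induct) (simp_all add: chi_add, simp add: chi_def)

lemma norm_chi [simp]: "norm (chi q k) = 1"
  by (simp add: chi_def)

lemma chi_eq_1_iff:
  assumes "q > 0"
  shows "chi q k = 1 \<longleftrightarrow> int q dvd k"
proof -
  have "chi q k = 1 \<longleftrightarrow> (\<exists>m::int. real_of_int k = of_int m * real q)"
    using assms by (auto simp: chi_def cis_conv_exp exp_eq_1 field_simps)
  also have "\<dots> \<longleftrightarrow> (\<exists>m. k = m * int q)"
    by (metis of_int_eq_iff of_int_mult of_int_of_nat_eq)
  finally show ?thesis by (auto simp: dvd_def mult.commute)
qed

text \<open>Allows the reductions modulo \<open>q\<close> in the walk to be dropped inside a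
  character.\<close>

lemma chi_cong:
  assumes "q > 0" "k mod int q = l mod int q"
  shows "chi q k = chi q l"
proof -
  have "chi q (k - l) = 1"
    using assms by (simp add: chi_eq_1_iff mod_eq_dvd_iff)
  then show ?thesis using chi_add[of q "k - l" l] by simp
qed

lemma chi_mult_nat: "chi q (int m * k) = chi q k ^ m"
  by (induction m) (simp_all add: chi_add ring_distribs, simp add: chi_def)

text \<open>Orthogonality: \<open>chi q k\<close> is a \<open>q\<close>-th root of unity, so the
  geometric sum over its powers vanishes unless it equals 1.\<close>

lemma sum_chi:
  assumes "q > 0"
  shows "(\<Sum>a\<in>{0..<int q}. chi q (a * k)) = (if int q dvd k then of_nat q else 0)"
proof -
  have "(\<Sum>a\<in>{0..<int q}. chi q (a * k)) = (\<Sum>a<q. chi q k ^ a)"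
    by (rule sum.reindex_bij_witness[of _ int nat]) (auto simp: chi_mult_nat[symmetric])
  moreover have "chi q k ^ q = 1"
    using assms by (simp add: chi_mult_nat[symmetric] chi_eq_1_iff)
  ultimately show ?thesis
    using chi_eq_1_iff[OF assms, of k] by (cases "chi q k = 1") (simp_all add: geometric_sum)
qed

section \<open>Fourier inversion on vectors of residues modulo q\<close>

abbreviation residue_vecs :: "nat \<Rightarrow> nat \<Rightarrow> (nat \<Rightarrow> int) set" where
  "residue_vecs q j \<equiv> {..<j} \<rightarrow>\<^sub>E {0..<int q}"

lemma finite_residue_vecs: "finite (residue_vecs q j)"
  by (intro finite_PiE) auto

lemma card_residue_vecs: "card (residue_vecs q j) = q ^ j"
  by (simp add: card_PiE)

lemma sum_chi_residue_vecs:
  assumes "q > 0"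
  shows "(\<Sum>y\<in>residue_vecs q j. chi q (\<Sum>r<j. y r * u r)) =
    (if \<forall>r<j. int q dvd u r then of_nat (q ^ j) else 0)"
proof -
  have "(\<Sum>y\<in>residue_vecs q j. chi q (\<Sum>r<j. y r * u r)) =
      (\<Sum>y\<in>residue_vecs q j. \<Prod>r<j. chi q (y r * u r))"
    by (simp add: chi_sum)
  also have "\<dots> = (\<Prod>r<j. \<Sum>a\<in>{0..<int q}. chi q (a * u r))"
    by (rule prod_sum_PiE[symmetric]) auto
  also have "\<dots> = (\<Prod>r<j. if int q dvd u r then of_nat q else 0)"
    using assms by (simp add: sum_chi)
  also have "\<dots> = (if \<forall>r<j. int q dvd u r then of_nat (q ^ j) else 0)"
    by (auto intro!: prod_zero)
  finally show ?thesis .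
qed

text \<open>After exchanging the sums, orthogonality leaves only the \<open>w\<close> congruent to
  \<open>v\<close> in every coordinate. Residue vectors are extensional with entries in
  \<open>{0..<int q}\<close>, so such a \<open>w\<close> equals \<open>v\<close>.\<close>

lemma fourier_inversion:
  fixes f :: "(nat \<Rightarrow> int) \<Rightarrow> complex"
  assumes q: "q > 0" and v: "v \<in> residue_vecs q j"
  shows "f v = (\<Sum>y\<in>residue_vecs q j.
    (\<Sum>w\<in>residue_vecs q j. f w * chi q (\<Sum>r<j. y r * - w r)) / of_nat (q ^ j)
      * chi q (\<Sum>r<j. y r * v r))"
proof -
  have "(\<Sum>y\<in>residue_vecs q j.
      (\<Sum>w\<in>residue_vecs q j. f w * chi q (\<Sum>r<j. y r * - w r)) / of_nat (q ^ j)
        * chi q (\<Sum>r<j. y r * v r))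
    = (\<Sum>y\<in>residue_vecs q j. \<Sum>w\<in>residue_vecs q j.
        f w / of_nat (q ^ j) * chi q (\<Sum>r<j. y r * (v r - w r)))"
  proof -
    have "chi q (\<Sum>r<j. y r * (v r - w r)) =
        chi q (\<Sum>r<j. y r * - w r) * chi q (\<Sum>r<j. y r * v r)" for y w
      unfolding chi_add[symmetric] sum.distrib[symmetric]
      by (intro arg_cong[of _ _ "chi q"] sum.cong) (auto simp: algebra_simps)
    then show ?thesis unfolding sum_distrib_right sum_divide_distrib
      by (simp only: mult.assoc times_divide_eq_left)
  qed
  also have "\<dots> = (\<Sum>w\<in>residue_vecs q j. f w / of_nat (q ^ j) *
      (\<Sum>y\<in>residue_vecs q j. chi q (\<Sum>r<j. y r * (v r - w r))))"
    by (subst sum.swap) (simp add: sum_distrib_left)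
  also have "\<dots> = (\<Sum>w\<in>residue_vecs q j. if w = v then f v else 0)"
  proof (intro sum.cong refl)
    fix w assume w: "w \<in> residue_vecs q j"
    have "(\<forall>r<j. int q dvd v r - w r) \<longleftrightarrow> w = v"
    proof
      assume *: "\<forall>r<j. int q dvd v r - w r"
      show "w = v"
      proof (rule PiE_ext[OF w v])
        fix r assume r: "r \<in> {..<j}"
        then have "v r mod int q = w r mod int q" using * by (simp add: mod_eq_dvd_iff)
        moreover have "v r \<in> {0..<int q}" "w r \<in> {0..<int q}" using PiE_mem[OF v r] PiE_mem[OF w r] by auto
        ultimately show "w r = v r" by simp
      qed
    qed simp
    then show "f w / of_nat (q ^ j) *
      (\<Sum>y\<in>residue_vecs q j. chi q (\<Sum>r<j. y r * (v r - w r))) = (if w = v then f v else 0)"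
      using q unfolding sum_chi_residue_vecs[OF q] by (cases "w = v") auto
  qed
  also have "\<dots> = f v" using v finite_residue_vecs[of j q] by (subst sum.delta) auto
  finally show ?thesis by (rule sym)
qed

section \<open>Expectations under the walk\<close>

definition walk_step :: "nat \<Rightarrow> nat \<Rightarrow> nat \<Rightarrow> int \<Rightarrow> int mat \<Rightarrow> int mat" where
  "walk_step n q i a X = mod_mat q (addrow_mat n a i (Suc i) * X)"

lemma walk_step_unitri:
  "q \<ge> 2 \<Longrightarrow> a \<in> {0..<int q} \<Longrightarrow> X \<in> unitri n q \<Longrightarrow> walk_step n q i a X \<in> unitri n q"
  unfolding walk_step_def by (intro unitri_mult_closed addrow_mat_unitri)

lemma walk_step_index:
  assumes "X \<in> unitri n q" "Suc i < n" "r < n" "c < n"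
  shows "walk_step n q i a X $$ (r, c) =
    (if r = i then (X $$ (i, c) + a * X $$ (Suc i, c)) mod int q else X $$ (r, c))"
proof -
  have X: "X \<in> carrier_mat n n" and XX: "X $$ (r, c) mod int q = X $$ (r, c)"
    using assms by (auto simp: unitri_iff)
  have "walk_step n q i a X = mod_mat q (addrow a i (Suc i) X)"
    unfolding walk_step_def using addrow_mat[OF X assms(2)] by simp
  then show ?thesis using X XX assms by (auto simp: mod_mat_def add.commute)
qed

lemma lazy_walk_eq:
  "lazy_walk n q X = pmf_of_set {0..<n - 1} \<bind>
     (\<lambda>i. pmf_of_set {0..<int q} \<bind> (\<lambda>a. return_pmf (walk_step n q i a X)))"
  by (simp add: lazy_walk_def walk_step_def unitri_group_def)

lemma expectation_lazy_walk:
  fixes F :: "int mat \<Rightarrow> complex"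
  assumes "n \<ge> 2" "q \<ge> 2"
  shows "measure_pmf.expectation (lazy_walk n q X) F =
    (\<Sum>i<n - 1. (\<Sum>a\<in>{0..<int q}. F (walk_step n q i a X)) / of_nat q) / of_nat (n - 1)"
proof -
  have fin: "finite (set_pmf (pmf_of_set {0..<int q} \<bind> (\<lambda>a. return_pmf (walk_step n q i a X))))" for i
    using assms by simp
  have "measure_pmf.expectation (lazy_walk n q X) F = (\<Sum>i\<in>{0..<n - 1}.
      measure_pmf.expectation (pmf_of_set {0..<int q} \<bind> (\<lambda>a. return_pmf (walk_step n q i a X))) F
      /\<^sub>R real (card {0..<n - 1}))"
    unfolding lazy_walk_eq using assms fin by (intro pmf_expectation_bind_pmf_of_set) auto
  also have "\<dots> = (\<Sum>i\<in>{0..<n - 1}. (\<Sum>a\<in>{0..<int q}.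
      measure_pmf.expectation (return_pmf (walk_step n q i a X)) F /\<^sub>R real (card {0..<int q}))
      /\<^sub>R real (card {0..<n - 1}))"
  proof (rule sum.cong[OF refl], rule arg_cong[where f = "\<lambda>x. x /\<^sub>R _"])
    fix i
    show "measure_pmf.expectation (pmf_of_set {0..<int q} \<bind> (\<lambda>a. return_pmf (walk_step n q i a X))) F
      = (\<Sum>a\<in>{0..<int q}.
          measure_pmf.expectation (return_pmf (walk_step n q i a X)) F /\<^sub>R real (card {0..<int q}))"
      using assms by (intro pmf_expectation_bind_pmf_of_set) auto
  qed
  finally show ?thesis
    by (simp add: scaleR_conv_of_real sum_divide_distrib atLeast0LessThan field_simps)
qed

lemma set_pmf_lazy_walk:
  assumes "n \<ge> 2" "q \<ge> 2" "X \<in> unitri n q"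
  shows "set_pmf (lazy_walk n q X) \<subseteq> unitri n q"
  unfolding lazy_walk_eq using assms walk_step_unitri[of q _ X n] by auto

lemma set_pmf_chain_law:
  assumes "n \<ge> 2" "q \<ge> 2" "X \<in> unitri n q"
  shows "set_pmf (chain_law (lazy_walk n q) X t) \<subseteq> unitri n q"
proof (induction t)
  case (Suc t)
  then show ?case using set_pmf_lazy_walk[OF assms(1,2)] by auto
qed (use assms in auto)

text \<open>The last step is pulled back to the test function. This turns the evolution of the law
  into a recursion on test functions.\<close>

lemma expectation_chain_law_Suc:
  fixes F :: "int mat \<Rightarrow> complex"
  assumes "n \<ge> 2" "q \<ge> 2" "X \<in> unitri n q"
  shows "measure_pmf.expectation (chain_law (lazy_walk n q) X (Suc t)) F =
    (\<Sum>i<n - 1. (\<Sum>a\<in>{0..<int q}.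
      measure_pmf.expectation (chain_law (lazy_walk n q) X t) (\<lambda>Y. F (walk_step n q i a Y))) / of_nat q)
    / of_nat (n - 1)"
proof -
  let ?p = "chain_law (lazy_walk n q) X t"
  have sub: "set_pmf ?p \<subseteq> unitri n q" by (rule set_pmf_chain_law[OF assms])
  have fin: "finite (set_pmf ?p)" using sub finite_unitri finite_subset by blast
  have fin2: "finite (set_pmf (lazy_walk n q Y))" if "Y \<in> set_pmf ?p" for Y
    using that sub set_pmf_lazy_walk[OF assms(1,2)] finite_unitri finite_subset by blast
  have int: "integrable (measure_pmf ?p) G" for G :: "int mat \<Rightarrow> complex"
    by (rule integrable_measure_pmf_finite[OF fin])
  have "measure_pmf.expectation (chain_law (lazy_walk n q) X (Suc t)) F =
     (\<Sum>Y\<in>set_pmf ?p. pmf ?p Y *\<^sub>R measure_pmf.expectation (lazy_walk n q Y) F)"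
    using fin fin2 by (simp add: pmf_expectation_bind[where A = "set_pmf ?p"])
  also have "\<dots> = measure_pmf.expectation ?p (\<lambda>Y. measure_pmf.expectation (lazy_walk n q Y) F)"
    using fin by (subst integral_measure_pmf[where A = "set_pmf ?p"]) auto
  also have "\<dots> = measure_pmf.expectation ?p (\<lambda>Y.
      (\<Sum>i<n - 1. (\<Sum>a\<in>{0..<int q}. F (walk_step n q i a Y)) / of_nat q) / of_nat (n - 1))"
    using assms by (simp add: expectation_lazy_walk)
  also have "\<dots> = (\<Sum>i<n - 1. (\<Sum>a\<in>{0..<int q}.
      measure_pmf.expectation ?p (\<lambda>Y. F (walk_step n q i a Y))) / of_nat q) / of_nat (n - 1)"
    by (simp add: int Bochner_Integration.integral_sum)
  finally show ?thesis .
qed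

lemma expectation_cong_pmf:
  fixes f g :: "'a \<Rightarrow> complex"
  assumes "\<And>x. x \<in> set_pmf p \<Longrightarrow> f x = g x"
  shows "measure_pmf.expectation p f = measure_pmf.expectation p g"
  using assms by (intro integral_cong_AE) (auto simp: AE_measure_pmf_iff)

lemma chi_sum_cong:
  assumes "q > 0" "finite A" "\<And>r. r \<in> A \<Longrightarrow> f r mod int q = g r mod int q"
  shows "chi q (sum f A) = chi q (sum g A)"
  unfolding chi_sum[OF assms(2)] using assms by (intro prod.cong chi_cong) auto

section \<open>Refreshing one entry of a row vector modulo a prime\<close>

definition nonzero_set :: "nat \<Rightarrow> nat \<Rightarrow> (nat \<Rightarrow> int) \<Rightarrow> nat set" where
  "nonzero_set q j y = {r. r < j \<and> \<not> int q dvd y r}"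

text \<open>Since \<open>u\<close> is invertible modulo the prime \<open>q\<close>, the affine map
  permutes the residues and takes the value 0 exactly once.\<close>

lemma ex1_dvd_affine:
  assumes q: "prime q" and u: "\<not> int q dvd u"
  obtains a where "a \<in> {0..<int q}"
    "\<And>a'. a' \<in> {0..<int q} \<Longrightarrow> int q dvd b + a' * u \<longleftrightarrow> a' = a"
proof -
  have q0: "q > 0" using q by (simp add: prime_gt_0_nat)
  let ?f = "\<lambda>a. (b + a * u) mod int q"
  have inj: "inj_on ?f {0..<int q}"
  proof (rule inj_onI)
    fix a c assume ac: "a \<in> {0..<int q}" "c \<in> {0..<int q}" and "?f a = ?f c"
    then have "int q dvd (b + a * u) - (b + c * u)" by (simp only: mod_eq_dvd_iff)
    then have "int q dvd (a - c) * u" by (simp add: algebra_simps)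
    then have "int q dvd a - c"
      using u q by (simp add: prime_dvd_mult_iff)
    then have "a mod int q = c mod int q" by (simp add: mod_eq_dvd_iff)
    then show "a = c" using ac by simp
  qed
  have "?f ` {0..<int q} \<subseteq> {0..<int q}" using q0 by auto
  then have "?f ` {0..<int q} = {0..<int q}"
    using inj by (intro endo_inj_surj) auto
  moreover have "0 \<in> {0..<int q}" using q0 by simp
  ultimately have "0 \<in> ?f ` {0..<int q}" by simp
  then obtain a where a: "a \<in> {0..<int q}" "?f a = 0" by auto
  show thesis
  proof (rule that[OF a(1)])
    fix a' assume a': "a' \<in> {0..<int q}"
    show "int q dvd b + a' * u \<longleftrightarrow> a' = a"
      using inj_on_eq_iff[OF inj a' a(1)] a(2) by (simp only: dvd_eq_mod_eq_0)
  qed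
qed

text \<open>Exactly one of the \<open>q\<close> values of \<open>a\<close> makes entry
  \<open>i + 1\<close> vanish. This identifies the rate \<open>s\<close> of the East process as
  \<open>1 / q\<close>.\<close>

lemma sum_front_weight_refresh:
  assumes q: "prime q" and i: "Suc i < j" "i \<in> nonzero_set q j y"
  shows "(\<Sum>a\<in>{0..<int q}. front_weight j (nonzero_set q j (y(Suc i := y (Suc i) + a * y i)))) / real q
    = (1 - 1 / real q) * front_weight j (insert (Suc i) (nonzero_set q j y))
      + 1 / real q * front_weight j (nonzero_set q j y - {Suc i})"
proof -
  let ?S = "nonzero_set q j y"
  have q0: "q > 0" using q by (simp add: prime_gt_0_nat)
  have "\<not> int q dvd y i" using i by (simp add: nonzero_set_def)
  from ex1_dvd_affine[OF q this, of "y (Suc i)"]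
  obtain a0 where a0: "a0 \<in> {0..<int q}"
    "\<And>a'. a' \<in> {0..<int q} \<Longrightarrow> int q dvd y (Suc i) + a' * y i \<longleftrightarrow> a' = a0" by blast
  have "nonzero_set q j (y(Suc i := y (Suc i) + a * y i)) =
      (if a = a0 then ?S - {Suc i} else insert (Suc i) ?S)" if "a \<in> {0..<int q}" for a
    using a0(2)[OF that] i by (auto simp: nonzero_set_def)
  then have "(\<Sum>a\<in>{0..<int q}. front_weight j (nonzero_set q j (y(Suc i := y (Suc i) + a * y i))))
     = (\<Sum>a\<in>{0..<int q}. if a = a0 then front_weight j (?S - {Suc i})
          else front_weight j (insert (Suc i) ?S))"
    by (intro sum.cong) auto
  also have "\<dots> = front_weight j (?S - {Suc i}) + (real q - 1) * front_weight j (insert (Suc i) ?S)"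
  proof -
    have "card ({0..<int q} - {a0}) = q - 1" using a0(1) by simp
    then show ?thesis using a0(1) q0
      by (subst sum.remove[of _ a0]) (auto simp: of_nat_diff)
  qed
  finally show ?thesis using q0 by (simp add: field_simps)
qed

section \<open>Decay of the Fourier coefficients of a column\<close>

text \<open>Only unitriangular arguments are constrained, because the law of the walk is supported
  on them.\<close>

definition column_test :: "nat \<Rightarrow> nat \<Rightarrow> nat \<Rightarrow> (int mat \<Rightarrow> complex) \<Rightarrow> bool" where
  "column_test n q j \<theta> \<longleftrightarrow> (\<forall>X\<in>unitri n q. norm (\<theta> X) \<le> 1) \<and>
     (\<forall>X\<in>unitri n q. \<forall>Y\<in>unitri n q.
        (\<forall>r<n. \<forall>c<j. X $$ (r, c) = Y $$ (r, c)) \<longrightarrow> \<theta> X = \<theta> Y)"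

text \<open>A row operation acts on each column separately, so the first \<open>j\<close> columns
  after the step depend only on the first \<open>j\<close> columns before it.\<close>

lemma column_test_step:
  assumes "column_test n q j \<theta>" "j < n" "Suc i < n" "q \<ge> 2" "a \<in> {0..<int q}"
  shows "column_test n q j (\<lambda>X. \<theta> (walk_step n q i a X))"
  unfolding column_test_def
proof (intro conjI ballI impI)
  fix X Y assume X: "X \<in> unitri n q" and Y: "Y \<in> unitri n q"
    and eq: "\<forall>r<n. \<forall>c<j. X $$ (r, c) = Y $$ (r, c)"
  have "\<forall>r<n. \<forall>c<j. walk_step n q i a X $$ (r, c) = walk_step n q i a Y $$ (r, c)"
    using eq assms X Y by (simp add: walk_step_index)
  then show "\<theta> (walk_step n q i a X) = \<theta> (walk_step n q i a Y)"
    using assms X Y walk_step_unitri[of q a _ n i] unfolding column_test_def by blast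
qed (use assms walk_step_unitri[of q a _ n i] in \<open>unfold column_test_def, blast\<close>)

definition column_phase :: "nat \<Rightarrow> nat \<Rightarrow> (nat \<Rightarrow> int) \<Rightarrow> int mat \<Rightarrow> complex" where
  "column_phase q j y X = chi q (\<Sum>r<j. y r * X $$ (r, j))"

text \<open>The row operation is transposed from the column to \<open>y\<close>: the extra term
  \<open>y i * a * X $$ (Suc i, j)\<close> is moved from index \<open>i\<close> to index
  \<open>i + 1\<close>, which still lies in the range of summation.\<close>

lemma column_phase_step_less:
  assumes X: "X \<in> unitri n q" and i: "Suc i < j" and j: "j < n" and q: "q > 0"
  shows "column_phase q j y (walk_step n q i a X) =
    column_phase q j (y(Suc i := y (Suc i) + a * y i)) X"
proof -
  have "column_phase q j y (walk_step n q i a X) =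
      chi q (\<Sum>r<j. y r * (X $$ (r, j) + (if r = i then a * X $$ (Suc i, j) else 0)))"
    unfolding column_phase_def using assms
    by (intro chi_sum_cong) (auto simp: walk_step_index mod_mult_right_eq)
  also have "(\<Sum>r<j. y r * (X $$ (r, j) + (if r = i then a * X $$ (Suc i, j) else 0))) =
      (\<Sum>r<j. y r * X $$ (r, j) + (if r = i then y i * a * X $$ (Suc i, j) else 0))"
    by (intro sum.cong) (auto simp: algebra_simps)
  also have "\<dots> = (\<Sum>r<j. y r * X $$ (r, j)) + y i * a * X $$ (Suc i, j)"
    using i by (simp add: sum.distrib)
  also have "\<dots> = (\<Sum>r<j. y r * X $$ (r, j) + (if r = Suc i then y i * a * X $$ (Suc i, j) else 0))"
    using i by (simp add: sum.distrib)
  also have "\<dots> = (\<Sum>r<j. (y(Suc i := y (Suc i) + a * y i)) r * X $$ (r, j))"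
    by (intro sum.cong) (auto simp: algebra_simps)
  finally show ?thesis by (simp add: column_phase_def)
qed

text \<open>Row \<open>j\<close> has the diagonal entry 1 in column \<open>j\<close>, so the step
  shifts the entry above it by the constant \<open>a\<close>.\<close>

lemma column_phase_step_eq:
  assumes X: "X \<in> unitri n q" and i: "Suc i = j" and j: "j < n" and q: "q > 0"
  shows "column_phase q j y (walk_step n q i a X) = chi q (a * y i) * column_phase q j y X"
proof -
  have [simp]: "X $$ (j, j) = 1" using X j by (simp add: unitri_iff)
  have "column_phase q j y (walk_step n q i a X) =
      chi q (\<Sum>r<j. y r * (X $$ (r, j) + (if r = i then a else 0)))"
    unfolding column_phase_def using assms
    by (intro chi_sum_cong) (auto simp: walk_step_index mod_mult_right_eq)
  also have "(\<Sum>r<j. y r * (X $$ (r, j) + (if r = i then a else 0))) =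
      (\<Sum>r<j. y r * X $$ (r, j) + (if r = i then a * y i else 0))"
    by (intro sum.cong) (auto simp: algebra_simps)
  also have "\<dots> = a * y i + (\<Sum>r<j. y r * X $$ (r, j))"
    using i by (simp add: sum.distrib)
  finally show ?thesis by (simp add: column_phase_def chi_add)
qed

lemma column_phase_step_ge:
  assumes X: "X \<in> unitri n q" and i: "j \<le> i" "Suc i < n"
  shows "column_phase q j y (walk_step n q i a X) = column_phase q j y X"
  using assms by (auto simp: column_phase_def walk_step_index intro!: arg_cong[where f = "chi q"] sum.cong)

text \<open>The added row \<open>j\<close> is zero to the left of the diagonal, hence the first
  \<open>j\<close> columns do not move.\<close>

lemma column_test_step_eq:
  assumes "column_test n q j \<theta>" "X \<in> unitri n q" "Suc i = j" "j < n" "q \<ge> 2" "a \<in> {0..<int q}"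
  shows "\<theta> (walk_step n q i a X) = \<theta> X"
proof -
  have "\<forall>r<n. \<forall>c<j. walk_step n q i a X $$ (r, c) = X $$ (r, c)"
    using assms by (auto simp: walk_step_index unitri_iff)
  then show ?thesis
    using assms walk_step_unitri[of q a X n i] unfolding column_test_def by blast
qed

text \<open>Induction on \<open>t\<close> with \<open>\<theta>\<close> and \<open>y\<close>
  arbitrary, since pulling back a step changes both. The supersolution property of
  \<open>front_weight\<close> then supplies one factor per step.\<close>

lemma fourier_decay:
  assumes n: "n \<ge> 2" and q: "prime q" and j: "1 \<le> j" "j < n" and x: "x \<in> unitri n q"
    and "column_test n q j \<theta>" and "nonzero_set q j y \<noteq> {}"
  shows "norm (measure_pmf.expectation (chain_law (lazy_walk n q) x t)
      (\<lambda>X. \<theta> X * column_phase q j y X))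
    \<le> (1 - 1 / (200 * real (n - 1))) ^ t * front_weight j (nonzero_set q j y)"
  using assms(6,7)
proof (induction t arbitrary: \<theta> y)
  case 0
  then have "norm (\<theta> x) \<le> 1" using x unfolding column_test_def by blast
  then show ?case
    using front_weight_ge_1[of j "nonzero_set q j y"]
    by (simp add: norm_mult column_phase_def)
next
  case (Suc t)
  have q2: "q \<ge> 2" using q by (rule prime_ge_2_nat)
  define E where "E = (\<lambda>F::int mat \<Rightarrow> complex.
    measure_pmf.expectation (chain_law (lazy_walk n q) x t) F)"
  define \<rho> where "\<rho> = 1 - 1 / (200 * real (n - 1))"
  have \<rho>: "\<rho> \<ge> 0" using n by (auto simp: \<rho>_def field_simps)
  let ?S = "nonzero_set q j y" and ?F = "\<lambda>X. \<theta> X * column_phase q j y X"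
  have S: "?S \<subseteq> {..<j}" by (auto simp: nonzero_set_def)
  have E_cong: "E F = E F'" if "\<And>X. X \<in> unitri n q \<Longrightarrow> F X = F' X" for F F'
    unfolding E_def using that set_pmf_chain_law[OF n q2 x, of t]
    by (intro expectation_cong_pmf) auto
  have IH: "norm (E (\<lambda>X. \<theta>' X * column_phase q j y' X)) \<le> \<rho> ^ t * front_weight j (nonzero_set q j y')"
    if "column_test n q j \<theta>'" "nonzero_set q j y' \<noteq> {}" for \<theta>' y'
    using Suc.IH[OF that] by (simp add: E_def \<rho>_def)
  \<comment> \<open>The averaged weight after an update at row \<open>i\<close>: refresh for
    \<open>i < j - 1\<close>, killing at \<open>i = j - 1\<close>, no change beyond.\<close>
  define R where "R = (\<lambda>i. if i < j - 1 then
      if i \<in> ?S then (1 - 1 / real q) * front_weight j (insert (Suc i) ?S)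
                     + 1 / real q * front_weight j (?S - {Suc i}) else front_weight j ?S
      else if i = j - 1 then (if j - 1 \<in> ?S then 0 else front_weight j ?S)
      else front_weight j ?S)"
  have bound: "norm ((\<Sum>a\<in>{0..<int q}. E (\<lambda>X. ?F (walk_step n q i a X))) / of_nat q) \<le> \<rho> ^ t * R i"
    if i: "i < n - 1" for i
  proof -
    have in': "Suc i < n" using i by simp
    have test: "column_test n q j (\<lambda>X. \<theta> (walk_step n q i a X))" if "a \<in> {0..<int q}" for a
      using column_test_step[OF Suc.prems(1) j(2) in' q2 that] .
    have avg: "norm ((\<Sum>a\<in>{0..<int q}. E (\<lambda>X. ?F (walk_step n q i a X))) / of_nat q) \<le>
        \<rho> ^ t * ((\<Sum>a\<in>{0..<int q}. f a) / real q)"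
      if "\<And>a. a \<in> {0..<int q} \<Longrightarrow> norm (E (\<lambda>X. ?F (walk_step n q i a X))) \<le> \<rho> ^ t * f a" for f
    proof -
      have "norm (\<Sum>a\<in>{0..<int q}. E (\<lambda>X. ?F (walk_step n q i a X))) \<le> (\<Sum>a\<in>{0..<int q}. \<rho> ^ t * f a)"
        using that by (rule sum_norm_le)
      then show ?thesis
        using q2 by (simp add: norm_divide divide_right_mono flip: sum_distrib_left)
    qed
    consider "i < j - 1" | "i = j - 1" | "j \<le> i" by linarith
    then show ?thesis
    proof cases
      case 1
      then have ij: "Suc i < j" by simp
      let ?y = "\<lambda>a. y(Suc i := y (Suc i) + a * y i)"
      \<comment> \<open>The induction hypothesis needs a nonzero vector. An occupied site
        \<open>i\<close> survives the update of its neighbour, and an empty one adds a multiple of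
        \<open>q\<close> and changes nothing modulo \<open>q\<close>.\<close>
      have ne: "nonzero_set q j (?y a) \<noteq> {}" for a
      proof (cases "i \<in> ?S")
        case True
        then have "i \<in> nonzero_set q j (?y a)" by (simp add: nonzero_set_def)
        then show ?thesis by auto
      next
        case False
        then have "nonzero_set q j (?y a) = ?S"
          using ij by (auto simp: nonzero_set_def dvd_add_left_iff)
        then show ?thesis using Suc.prems(2) by simp
      qed
      have "norm (E (\<lambda>X. ?F (walk_step n q i a X))) \<le> \<rho> ^ t * front_weight j (nonzero_set q j (?y a))"
        if a: "a \<in> {0..<int q}" for a
      proof -
        have "E (\<lambda>X. ?F (walk_step n q i a X)) =
            E (\<lambda>X. \<theta> (walk_step n q i a X) * column_phase q j (?y a) X)"
          using ij j q2 by (intro E_cong) (simp add: column_phase_step_less)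
        then show ?thesis using IH[OF test[OF a] ne[of a]] by simp
      qed
      note le = avg[OF this]
      show ?thesis
      proof (cases "i \<in> ?S")
        case True
        then show ?thesis using le 1 sum_front_weight_refresh[OF q ij True] by (simp add: R_def)
      next
        case False
        then have "nonzero_set q j (?y a) = ?S" for a
          using ij by (auto simp: nonzero_set_def dvd_add_left_iff)
        then show ?thesis using le 1 False q2 by (simp add: R_def)
      qed
    next
      case 2
      then have ij: "Suc i = j" using j by simp
      \<comment> \<open>The parameter \<open>a\<close> enters only through a phase, so averaging
        over \<open>a\<close> gives zero unless \<open>q\<close> divides \<open>y i\<close>.\<close>
      have "E (\<lambda>X. ?F (walk_step n q i a X)) = chi q (a * y i) * E ?F" if a: "a \<in> {0..<int q}" for a
      proof -
        have "E (\<lambda>X. ?F (walk_step n q i a X)) = E (\<lambda>X. chi q (a * y i) * ?F X)"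
          using ij j q2 a column_test_step_eq[OF Suc.prems(1) _ ij j(2) q2 a]
          by (intro E_cong) (simp add: column_phase_step_eq)
        then show ?thesis by (simp add: E_def)
      qed
      then have "(\<Sum>a\<in>{0..<int q}. E (\<lambda>X. ?F (walk_step n q i a X))) =
          (\<Sum>a\<in>{0..<int q}. chi q (a * y i)) * E ?F"
        by (simp add: sum_distrib_right)
      also have "\<dots> = (if i \<in> ?S then 0 else of_nat q * E ?F)"
        using q2 ij by (auto simp: sum_chi nonzero_set_def)
      finally show ?thesis
        using IH[OF Suc.prems] q2 2 by (simp add: R_def)
    next
      case 3
      have "norm (E (\<lambda>X. ?F (walk_step n q i a X))) \<le> \<rho> ^ t * front_weight j ?S"
        if a: "a \<in> {0..<int q}" for a
      proof -
        have "E (\<lambda>X. ?F (walk_step n q i a X)) = E (\<lambda>X. \<theta> (walk_step n q i a X) * column_phase q j y X)"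
          using 3 in' by (intro E_cong) (simp add: column_phase_step_ge)
        then show ?thesis using IH[OF test[OF a] Suc.prems(2)] by simp
      qed
      from avg[OF this] show ?thesis using 3 j q2 by (simp add: R_def)
    qed
  qed
  \<comment> \<open>The rows below \<open>j\<close> form the killed East process, with
    \<open>s = 1 / q\<close> at most 1/2. The remaining \<open>n - 1 - j\<close> rows contribute the
    unchanged weight.\<close>
  have "(\<Sum>i<n - 1. R i) = (\<Sum>i<j. R i) + (\<Sum>i\<in>{j..<n - 1}. R i)"
    using j by (simp add: sum.atLeastLessThan_concat flip: atLeast0LessThan)
  also have "(\<Sum>i<j. R i) = (\<Sum>i<j - 1. R i) + R (j - 1)"
    using j sum.lessThan_Suc[of R "j - 1"] by simp
  also have "(\<Sum>i<j - 1. R i) + R (j - 1) \<le> (real j - 1/200) * front_weight j ?S"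
  proof -
    have "1 / real q \<le> 1 / 2" using q2 by simp
    from front_weight_drift[OF S Suc.prems(2) _ this] show ?thesis by (simp add: R_def)
  qed
  also have "(\<Sum>i\<in>{j..<n - 1}. R i) = (real (n - 1) - real j) * front_weight j ?S"
  proof -
    have "(\<Sum>i\<in>{j..<n - 1}. R i) = (\<Sum>i\<in>{j..<n - 1}. front_weight j ?S)"
      using j by (intro sum.cong) (auto simp: R_def)
    then show ?thesis using j by (simp add: of_nat_diff)
  qed
  also have "(real j - 1/200) * front_weight j ?S + (real (n - 1) - real j) * front_weight j ?S
      = (real (n - 1) - 1/200) * front_weight j ?S"
    by (simp add: algebra_simps)
  also have "real (n - 1) - 1/200 = \<rho> * real (n - 1)"
  proof -
    have "m - 1/200 = (1 - 1 / (200 * m)) * m" if "m \<noteq> 0" for m :: real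
      using that by (simp add: field_simps)
    from this[of "real (n - 1)"] show ?thesis using n by (simp add: \<rho>_def)
  qed
  finally have sumR: "(\<Sum>i<n - 1. R i) \<le> \<rho> * real (n - 1) * front_weight j ?S"
    by simp
  have "norm (measure_pmf.expectation (chain_law (lazy_walk n q) x (Suc t)) ?F) =
    norm (\<Sum>i<n - 1. (\<Sum>a\<in>{0..<int q}. E (\<lambda>X. ?F (walk_step n q i a X))) / of_nat q) / real (n - 1)"
    unfolding expectation_chain_law_Suc[OF n q2 x] E_def by (simp add: norm_divide)
  also have "\<dots> \<le> (\<Sum>i<n - 1. \<rho> ^ t * R i) / real (n - 1)"
    using bound by (intro divide_right_mono sum_norm_le) auto
  also have "\<dots> \<le> \<rho> ^ t * (\<rho> * real (n - 1) * front_weight j ?S) / real (n - 1)"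
    unfolding sum_distrib_left[symmetric]
    using sumR \<rho> by (intro divide_right_mono mult_left_mono) auto
  also have "\<dots> = \<rho> ^ Suc t * front_weight j ?S" using n by simp
  finally show ?case unfolding \<rho>_def .
qed

section \<open>Averaging out the columns\<close>

definition set_column :: "nat \<Rightarrow> nat \<Rightarrow> (nat \<Rightarrow> int) \<Rightarrow> int mat \<Rightarrow> int mat" where
  "set_column n j w X = mat n n (\<lambda>(r, c). if c = j \<and> r < j then w r else X $$ (r, c))"

lemma set_column_unitri:
  assumes "X \<in> unitri n q" "w \<in> residue_vecs q j" "j < n"
  shows "set_column n j w X \<in> unitri n q"
proof -
  have "0 \<le> w r" "w r < int q" if "r < j" for r
    using PiE_mem[OF assms(2), of r] that by auto
  then show ?thesis using assms(1,3) by (auto simp: unitri_iff set_column_def)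
qed

lemma set_column_self:
  assumes "X \<in> unitri n q" "j < n"
  shows "set_column n j (\<lambda>r\<in>{..<j}. X $$ (r, j)) X = X"
  using assms by (intro eq_matI) (auto simp: set_column_def unitri_iff)

text \<open>On and below the diagonal column \<open>j\<close> is fixed by unitriangularity, and
  above it both matrices receive \<open>w\<close>.\<close>

lemma set_column_agree:
  assumes "X \<in> unitri n q" "Y \<in> unitri n q" "j < n"
    and "\<forall>r<n. \<forall>c<j. X $$ (r, c) = Y $$ (r, c)"
  shows "\<forall>r<n. \<forall>c<Suc j. set_column n j w X $$ (r, c) = set_column n j w Y $$ (r, c)"
proof (intro allI impI)
  fix r c assume r: "r < n" and c: "c < Suc j"
  consider "c < j" | "c = j" "r < j" | "c = j" "r = j" | "c = j" "j < r" using c by linarith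
  then show "set_column n j w X $$ (r, c) = set_column n j w Y $$ (r, c)"
    using assms r by cases (simp_all add: set_column_def unitri_iff)
qed

text \<open>The Fourier coefficient at \<open>y\<close> of \<open>F\<close> as a function of column
  \<open>j\<close> alone, with the other columns taken from \<open>X\<close>.\<close>

definition column_coeff ::
    "nat \<Rightarrow> nat \<Rightarrow> nat \<Rightarrow> (int mat \<Rightarrow> complex) \<Rightarrow> (nat \<Rightarrow> int) \<Rightarrow> int mat \<Rightarrow> complex" where
  "column_coeff n q j F y X =
     (\<Sum>w\<in>residue_vecs q j. F (set_column n j w X) * chi q (\<Sum>r<j. y r * - w r)) / of_nat (q ^ j)"

text \<open>The coefficient at \<open>y = 0\<close> is the average of \<open>F\<close> over all values of column \<open>j\<close>.\<close>

lemma column_test_column_coeff: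
  assumes F: "column_test n q (Suc j) F" and j: "j < n" and q: "q > 0"
  shows "column_test n q j (column_coeff n q j F y)"
  unfolding column_test_def
proof (intro conjI ballI impI)
  fix X assume X: "X \<in> unitri n q"
  have "norm (\<Sum>w\<in>residue_vecs q j. F (set_column n j w X) * chi q (\<Sum>r<j. y r * - w r))
      \<le> (\<Sum>w\<in>residue_vecs q j. 1)"
  proof (rule sum_norm_le)
    fix w assume "w \<in> residue_vecs q j"
    then show "norm (F (set_column n j w X) * chi q (\<Sum>r<j. y r * - w r)) \<le> 1"
      using F set_column_unitri[OF X _ j] unfolding column_test_def norm_mult norm_chi by auto
  qed
  then show "norm (column_coeff n q j F y X) \<le> 1"
    using q by (simp add: column_coeff_def norm_divide norm_power card_residue_vecs)
next
  fix X Y assume X: "X \<in> unitri n q" and Y: "Y \<in> unitri n q"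
    and eq: "\<forall>r<n. \<forall>c<j. X $$ (r, c) = Y $$ (r, c)"
  have "F (set_column n j w X) = F (set_column n j w Y)" if "w \<in> residue_vecs q j" for w
    using F set_column_unitri[OF X that j] set_column_unitri[OF Y that j]
      set_column_agree[OF X Y j eq, of w] unfolding column_test_def by blast
  then show "column_coeff n q j F y X = column_coeff n q j F y Y"
    unfolding column_coeff_def by (intro arg_cong[where f = "\<lambda>x. x / _"] sum.cong) auto
qed

lemma column_expansion:
  assumes "X \<in> unitri n q" "j < n" "q > 0"
  shows "F X = (\<Sum>y\<in>residue_vecs q j. column_coeff n q j F y X * column_phase q j y X)"
proof -
  define v where "v = (\<lambda>r\<in>{..<j}. X $$ (r, j))"
  have v: "v \<in> residue_vecs q j" using assms by (auto simp: v_def unitri_iff)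
  have "(\<Sum>r<j. y r * v r) = (\<Sum>r<j. y r * X $$ (r, j))" for y
    by (simp add: v_def)
  then show ?thesis
    using fourier_inversion[OF assms(3) v, of "\<lambda>w. F (set_column n j w X)"]
    using set_column_self[OF assms(1,2)]
    by (simp only: column_coeff_def column_phase_def flip: v_def)
qed

text \<open>In the expansion over \<open>y\<close> the zero vector gives the averaged function
  exactly. Each of the fewer than \<open>q ^ j\<close> other terms is small by
  \<open>fourier_decay\<close>.\<close>

lemma column_average_error:
  fixes t n q :: nat
  defines "\<delta> \<equiv> 2 * (2 * real q) ^ n * (1 - 1 / (200 * real (n - 1))) ^ t"
  assumes n: "n \<ge> 2" and q: "prime q" and j: "1 \<le> j" "j < n" and x: "x \<in> unitri n q"
    and F: "column_test n q (Suc j) F"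
  shows "norm (measure_pmf.expectation (chain_law (lazy_walk n q) x t) F
      - measure_pmf.expectation (chain_law (lazy_walk n q) x t) (column_coeff n q j F (\<lambda>r\<in>{..<j}. 0)))
    \<le> \<delta>"
proof -
  have q2: "q \<ge> 2" using q by (rule prime_ge_2_nat)
  define \<rho> where "\<rho> = 1 - 1 / (200 * real (n - 1))"
  have \<rho>: "\<rho> \<ge> 0" using n by (auto simp: \<rho>_def field_simps)
  let ?z = "\<lambda>r\<in>{..<j}. 0 :: int" and ?V = "residue_vecs q j"
  let ?p = "chain_law (lazy_walk n q) x t"
  let ?G = "\<lambda>y X. column_coeff n q j F y X * column_phase q j y X"
  have z: "?z \<in> ?V" using q2 by auto
  have sub: "set_pmf ?p \<subseteq> unitri n q" by (rule set_pmf_chain_law[OF n q2 x])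
  then have fin: "finite (set_pmf ?p)" using finite_unitri finite_subset by blast
  have int: "integrable (measure_pmf ?p) G" for G :: "int mat \<Rightarrow> complex"
    by (rule integrable_measure_pmf_finite[OF fin])
  have "F X = (\<Sum>y\<in>?V. ?G y X)" if "X \<in> set_pmf ?p" for X
    using that sub q2 by (intro column_expansion[OF _ j(2)]) auto
  then have "measure_pmf.expectation ?p F = measure_pmf.expectation ?p (\<lambda>X. \<Sum>y\<in>?V. ?G y X)"
    by (rule expectation_cong_pmf)
  also have "\<dots> = (\<Sum>y\<in>?V. measure_pmf.expectation ?p (?G y))"
    by (rule Bochner_Integration.integral_sum) (rule int)
  also have "\<dots> = measure_pmf.expectation ?p (?G ?z) + (\<Sum>y\<in>?V - {?z}. measure_pmf.expectation ?p (?G y))"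
    by (rule sum.remove[OF finite_residue_vecs z])
  also have "?G ?z = column_coeff n q j F ?z"
    by (simp add: column_phase_def chi_def)
  finally have "norm (measure_pmf.expectation ?p F - measure_pmf.expectation ?p (column_coeff n q j F ?z))
      = norm (\<Sum>y\<in>?V - {?z}. measure_pmf.expectation ?p (?G y))"
    by (simp only: add_diff_cancel_left')
  also have "\<dots> \<le> (\<Sum>y\<in>?V - {?z}. \<rho> ^ t * (2 * (10/9) ^ j))"
  proof (rule sum_norm_le)
    fix y assume y: "y \<in> ?V - {?z}"
    have "nonzero_set q j y \<noteq> {}"
    proof
      assume empty: "nonzero_set q j y = {}"
      have "y = ?z"
      proof (rule PiE_ext)
        show "y \<in> ?V" "?z \<in> ?V" using y z by auto
        fix r assume r: "r \<in> {..<j}"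
        then have "int q dvd y r" using empty by (auto simp: nonzero_set_def)
        moreover have "y r \<in> {0..<int q}" using PiE_mem[of y "{..<j}" "\<lambda>_. {0..<int q}" r] y r by blast
        ultimately have "y r = 0" using zdvd_not_zless[of "y r" "int q"] by fastforce
        then show "y r = ?z r" using r by simp
      qed
      then show False using y by simp
    qed
    then have "norm (measure_pmf.expectation ?p (?G y)) \<le> \<rho> ^ t * front_weight j (nonzero_set q j y)"
      using fourier_decay[OF n q j x column_test_column_coeff[OF F j(2)], of y t] q2
      by (simp add: \<rho>_def)
    also have "\<dots> \<le> \<rho> ^ t * (2 * (10/9) ^ j)"
      using \<rho> by (intro mult_left_mono front_weight_le) auto
    finally show "norm (measure_pmf.expectation ?p (?G y)) \<le> \<rho> ^ t * (2 * (10/9) ^ j)" .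
  qed
  also have "\<dots> \<le> (\<Sum>y\<in>?V. \<rho> ^ t * (2 * (10/9) ^ j))"
    using \<rho> finite_residue_vecs by (intro sum_mono2) auto
  also have "\<dots> = 2 * (10/9 * real q) ^ j * \<rho> ^ t"
    by (simp add: card_residue_vecs power_mult_distrib power_divide)
  \<comment> \<open>A crude enlargement that makes the error independent of \<open>j\<close>, so
    that the errors of all columns simply add up.\<close>
  also have "\<dots> \<le> 2 * (2 * real q) ^ n * \<rho> ^ t"
  proof -
    have "(10/9 * real q) ^ j \<le> (2 * real q) ^ j" by (intro power_mono) auto
    also have "\<dots> \<le> (2 * real q) ^ n" using j q2 by (intro power_increasing) auto
    finally show ?thesis using \<rho> by (intro mult_right_mono) auto
  qed
  finally show ?thesis by (simp add: \<delta>_def \<rho>_def)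
qed

text \<open>Columns are averaged out from \<open>k - 1\<close> down to 1, each at cost
  \<open>\<delta>\<close>. Column 0 is the same for all unitriangular matrices, so what remains is
  constant. What matters is that \<open>\<kappa>\<close> does not depend on the starting point
  \<open>x\<close>.\<close>

lemma column_test_expectation_approx:
  fixes t n q :: nat
  defines "\<delta> \<equiv> 2 * (2 * real q) ^ n * (1 - 1 / (200 * real (n - 1))) ^ t"
  assumes n: "n \<ge> 2" and q: "prime q" and "1 \<le> k" "k \<le> n" and "column_test n q k F"
  shows "\<exists>\<kappa>. \<forall>x\<in>unitri n q.
    norm (measure_pmf.expectation (chain_law (lazy_walk n q) x t) F - \<kappa>) \<le> real (k - 1) * \<delta>"
  using assms(4-6)
proof (induction k arbitrary: F rule: dec_induct)
  case base
  have q2: "q \<ge> 2" using q by (rule prime_ge_2_nat)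
  have const: "F X = F (1\<^sub>m n)" if X: "X \<in> unitri n q" for X
  proof -
    have "\<forall>r<n. \<forall>c<1. X $$ (r, c) = 1\<^sub>m n $$ (r, c)"
      using X by (auto simp: unitri_iff)
    then show ?thesis
      using base X one_unitri[OF q2, of n] unfolding column_test_def by blast
  qed
  have "measure_pmf.expectation (chain_law (lazy_walk n q) x t) F = F (1\<^sub>m n)"
    if x: "x \<in> unitri n q" for x
  proof -
    have "measure_pmf.expectation (chain_law (lazy_walk n q) x t) F =
        measure_pmf.expectation (chain_law (lazy_walk n q) x t) (\<lambda>_. F (1\<^sub>m n))"
      using const set_pmf_chain_law[OF n q2 x] by (intro expectation_cong_pmf) auto
    then show ?thesis by simp
  qed
  then show ?case by (intro exI[of _ "F (1\<^sub>m n)"]) simp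
next
  case (step j)
  have q2: "q \<ge> 2" using q by (rule prime_ge_2_nat)
  let ?A = "column_coeff n q j F (\<lambda>r\<in>{..<j}. 0)"
  have j: "1 \<le> j" "j < n" using step by auto
  have "column_test n q j ?A"
    using step.prems(2) j q2 by (intro column_test_column_coeff) auto
  then obtain \<kappa> where \<kappa>: "\<forall>x\<in>unitri n q.
      norm (measure_pmf.expectation (chain_law (lazy_walk n q) x t) ?A - \<kappa>) \<le> real (j - 1) * \<delta>"
    using step.IH j by auto
  show ?case
  proof (intro exI[of _ \<kappa>] ballI)
    fix x assume x: "x \<in> unitri n q"
    let ?E = "measure_pmf.expectation (chain_law (lazy_walk n q) x t)"
    have "norm (?E F - \<kappa>) \<le> norm (?E F - ?E ?A) + norm (?E ?A - \<kappa>)"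
      using norm_triangle_ineq[of "?E F - ?E ?A" "?E ?A - \<kappa>"] by simp
    also have "\<dots> \<le> \<delta> + real (j - 1) * \<delta>"
      using \<kappa> x column_average_error[OF n q j x step.prems(2), of t]
      unfolding \<delta>_def by (intro add_mono) auto
    also have "\<dots> = real (Suc j - 1) * \<delta>" using j by (simp add: of_nat_diff algebra_simps)
    finally show "norm (?E F - \<kappa>) \<le> real (Suc j - 1) * \<delta>" .
  qed
qed

section \<open>From test functions to total variation distance and mixing time\<close>

lemma bind_chain_law_stationary:
  assumes "bind_pmf \<nu> K = \<nu>"
  shows "bind_pmf \<nu> (\<lambda>y. chain_law K y t) = \<nu>"
  using assms by (induction t) (simp_all add: bind_return_pmf' flip: bind_assoc_pmf)

text \<open>For the indicator of an event, the value \<open>\<kappa>\<close> is common to all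
  starting points. Averaging over a uniform start, which stationarity preserves, puts the uniform
  probability within the same distance of \<open>\<kappa>\<close>, and the triangle inequality
  doubles the error.\<close>

lemma tv_dist_lazy_walk:
  fixes t n q :: nat
  defines "\<delta> \<equiv> 2 * (2 * real q) ^ n * (1 - 1 / (200 * real (n - 1))) ^ t"
  assumes n: "n \<ge> 2" and q: "prime q" and x: "x \<in> unitri n q"
  shows "tv_dist (unitri n q) (chain_law (lazy_walk n q) x t) (pmf_of_set (unitri n q))
    \<le> 2 * real n * \<delta>"
  unfolding tv_dist_def
proof (rule cSUP_least)
  fix A assume A: "A \<in> Pow (unitri n q)"
  have q2: "q \<ge> 2" using q by (rule prime_ge_2_nat)
  let ?U = "pmf_of_set (unitri n q)" and ?L = "\<lambda>y. chain_law (lazy_walk n q) y t"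
  let ?F = "indicator A :: int mat \<Rightarrow> complex"
  have ne: "unitri n q \<noteq> {}" using x by auto
  have "column_test n q n ?F"
    unfolding column_test_def
  proof (intro conjI ballI impI)
    fix X Y assume "X \<in> unitri n q" "Y \<in> unitri n q" "\<forall>r<n. \<forall>c<n. X $$ (r, c) = Y $$ (r, c)"
    then have "X = Y" by (intro eq_matI) (auto simp: unitri_iff)
    then show "?F X = ?F Y" by simp
  qed (simp add: indicator_def)
  from column_test_expectation_approx[OF n q _ _ this, of t] n
  obtain \<kappa> where \<kappa>: "\<And>y. y \<in> unitri n q \<Longrightarrow>
      norm (measure_pmf.expectation (?L y) ?F - \<kappa>) \<le> real (n - 1) * \<delta>"
    unfolding \<delta>_def by auto
  have \<delta>: "\<delta> \<ge> 0" using n by (simp add: \<delta>_def field_simps)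
  have E_prob: "measure_pmf.expectation p ?F = of_real (measure_pmf.prob p A)" for p
  proof -
    have "measure_pmf.expectation p ?F = measure_pmf.expectation p (\<lambda>X. of_real (indicator A X))"
      by (intro expectation_cong_pmf) (simp add: indicator_def)
    then show ?thesis by simp
  qed
  have close: "norm (of_real (measure_pmf.prob (?L y) A) - \<kappa>) \<le> real n * \<delta>" if "y \<in> unitri n q" for y
    using \<kappa>[OF that] mult_right_mono[OF _ \<delta>, of "real (n - 1)" "real n"] unfolding E_prob by simp
  have "bind_pmf ?U ?L = ?U"
    using bind_chain_law_stationary[OF lazy_walk_stationary[OF n q2], of t]
    by (simp add: unitri_group_def)
  then have "complex_of_real (measure_pmf.prob ?U A) = measure_pmf.expectation (bind_pmf ?U ?L) ?F"
    by (simp add: E_prob)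
  also have "\<dots> = (\<Sum>y\<in>unitri n q. measure_pmf.expectation (?L y) ?F /\<^sub>R real (card (unitri n q)))"
  proof (rule pmf_expectation_bind_pmf_of_set[OF ne finite_unitri])
    fix y assume "y \<in> unitri n q"
    then show "finite (set_pmf (?L y))"
      using set_pmf_chain_law[OF n q2] finite_unitri finite_subset by blast
  qed
  finally have prob_U: "complex_of_real (measure_pmf.prob ?U A) =
      (\<Sum>y\<in>unitri n q. of_real (measure_pmf.prob (?L y) A)) / of_nat (card (unitri n q))"
    by (simp add: E_prob sum_divide_distrib scaleR_conv_of_real field_simps)
  have card: "card (unitri n q) > 0" using ne finite_unitri by (simp add: card_gt_0_iff)
  have "of_real (measure_pmf.prob ?U A) - \<kappa> =
      (\<Sum>y\<in>unitri n q. of_real (measure_pmf.prob (?L y) A) - \<kappa>) / of_nat (card (unitri n q))"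
    using card by (simp add: prob_U sum_subtractf diff_divide_distrib)
  also have "norm \<dots> \<le> (\<Sum>y\<in>unitri n q. real n * \<delta>) / real (card (unitri n q))"
    unfolding norm_divide norm_of_nat using close by (intro divide_right_mono sum_norm_le) auto
  also have "\<dots> = real n * \<delta>" using card by simp
  finally have U: "norm (of_real (measure_pmf.prob ?U A) - \<kappa>) \<le> real n * \<delta>" .
  have "\<bar>measure_pmf.prob (?L x) A - measure_pmf.prob ?U A\<bar> =
      norm (complex_of_real (measure_pmf.prob (?L x) A - measure_pmf.prob ?U A))"
    by (simp only: norm_of_real)
  also have "\<dots> = norm ((of_real (measure_pmf.prob (?L x) A) - \<kappa>) - (of_real (measure_pmf.prob ?U A) - \<kappa>))"
    by simp
  also have "\<dots> \<le> real n * \<delta> + real n * \<delta>"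
    by (intro order_trans[OF norm_triangle_ineq4] add_mono close[OF x] U)
  finally show "\<bar>measure_pmf.prob (?L x) A - measure_pmf.prob ?U A\<bar> \<le> 2 * real n * \<delta>"
    by (simp add: algebra_simps)
qed auto

lemma lazy_walk_mixing_time_le:
  assumes n: "n \<ge> 2" and q: "prime q" and t: "real t \<ge> 1200 * real n ^ 2 * ln (real q)"
  shows "lazy_walk_mixing_time n q \<le> enat t"
proof -
  have q2: "q \<ge> 2" using q by (rule prime_ge_2_nat)
  define \<rho> where "\<rho> = 1 - 1 / (200 * real (n - 1))"
  have \<rho>: "\<rho> \<ge> 0" using n by (auto simp: \<rho>_def field_simps)
  have "\<rho> \<le> 1 - 1 / (200 * real n)"
    using n unfolding \<rho>_def by (intro diff_left_mono divide_left_mono) auto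
  also have "\<dots> \<le> exp (- (1 / (200 * real n)))"
    using exp_ge_add_one_self[of "- (1 / (200 * real n))"] by simp
  finally have "\<rho> ^ t \<le> exp (- (1 / (200 * real n))) ^ t" using \<rho> by (rule power_mono)
  also have "\<dots> = exp (- (real t / (200 * real n)))" by (simp flip: exp_of_nat_mult)
  \<comment> \<open>This fixes the constant 1200 = 6 * 200: the exponent \<open>6 * n\<close> leaves
    room for the prefactor, which is at most \<open>real q ^ (6 * n) / 8\<close>.\<close>
  also have "\<dots> \<le> exp (- (real (6 * n) * ln (real q)))"
    using t n by (simp add: field_simps power2_eq_square)
  also have "\<dots> = 1 / real q ^ (6 * n)"
  proof -
    have "exp (real (6 * n) * ln (real q)) = real q ^ (6 * n)"
      using q2 by (subst exp_of_nat_mult) simp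
    then show ?thesis by (simp only: exp_minus inverse_eq_divide)
  qed
  finally have \<rho>t: "\<rho> ^ t \<le> 1 / real q ^ (6 * n)" .
  have "2 * real n * (2 * (2 * real q) ^ n) \<le> 2 * 2 ^ n * (2 * (2 ^ n * real q ^ n))"
    unfolding power_mult_distrib[symmetric]
    using less_exp[of n] by (intro mult_mono) (auto simp: power_mult_distrib simp flip: of_nat_less_iff)
  also have "\<dots> = 2 ^ (2 * n + 2) * real q ^ n"
  proof -
    have "(4::real) ^ n = 2 ^ n * 2 ^ n" by (simp flip: power_mult_distrib)
    then show ?thesis by (simp add: power_add power_mult)
  qed
  finally have pre: "2 * real n * (2 * (2 * real q) ^ n) * 8 \<le> 2 ^ (2 * n + 5) * real q ^ n"
    by (simp add: power_add)
  also have "\<dots> \<le> real q ^ (5 * n) * real q ^ n"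
  proof (rule mult_right_mono)
    \<comment> \<open>Uses \<open>2 * n + 5 \<le> 5 * n\<close>, which holds from
      \<open>n = 2\<close> on.\<close>
    have "(2::real) ^ (2 * n + 5) \<le> 2 ^ (5 * n)" using n by (intro power_increasing) auto
    also have "\<dots> \<le> real q ^ (5 * n)" using q2 by (intro power_mono) auto
    finally show "2 ^ (2 * n + 5) \<le> real q ^ (5 * n)" .
  qed auto
  also have "\<dots> = real q ^ (6 * n)" by (simp flip: power_add)
  finally have "2 * real n * (2 * (2 * real q) ^ n) \<le> real q ^ (6 * n) / 8" by simp
  then have "2 * real n * (2 * (2 * real q) ^ n) * \<rho> ^ t \<le> real q ^ (6 * n) / 8 * (1 / real q ^ (6 * n))"
    using \<rho>t \<rho> by (intro mult_mono) auto
  also have "\<dots> = 1 / 8" using q2 by simp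
  finally have le: "2 * real n * (2 * (2 * real q) ^ n * \<rho> ^ t) \<le> 1 / 8" by (simp add: mult.assoc)
  have "(SUP y\<in>unitri n q. tv_dist (unitri n q) (chain_law (lazy_walk n q) y t) (pmf_of_set (unitri n q)))
      \<le> 1 / 8"
  proof (rule cSUP_least)
    fix y assume "y \<in> unitri n q"
    from order_trans[OF tv_dist_lazy_walk[OF n q this] le[unfolded \<rho>_def]]
    show "tv_dist (unitri n q) (chain_law (lazy_walk n q) y t) (pmf_of_set (unitri n q)) \<le> 1 / 8" .
  qed (use one_unitri[OF q2, of n] in auto)
  \<comment> \<open>Since e is at most 3, \<open>2 * exp 1\<close> is at most 6 and hence below
    8.\<close>
  also have "1 / 8 < 1 / (2 * exp (1::real))"
    using exp_le by (intro divide_strict_left_mono) auto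
  finally show ?thesis
    unfolding lazy_walk_mixing_time_def mixing_time_def unitri_group_def
    by (intro Inf_lower) simp
qed

theorem theorem2:
  shows "\<exists>C::real. C > 0 \<and>
    (\<forall>n q :: nat. n \<ge> 2 \<longrightarrow> prime q \<longrightarrow>
      ereal_of_enat (lazy_walk_mixing_time n q) \<le> ereal (C * real n ^ 2 * ln (real q)))"
proof (intro exI[of _ 1201] conjI allI impI)
  fix n q :: nat
  assume n: "n \<ge> 2" and q: "prime q"
  define T where "T = real n ^ 2 * ln (real q)"
  define t where "t = nat \<lceil>1200 * T\<rceil>"
  have "2 ^ 2 * (2/3) \<le> T"
    unfolding T_def
  proof (rule mult_mono)
    show "(2::real) ^ 2 \<le> real n ^ 2" using n by (intro power_mono) auto
    have "ln 2 \<le> ln (real q)" using prime_ge_2_nat[OF q] by simp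
    then show "2/3 \<le> ln (real q)" using ln2_ge_two_thirds by linarith
  qed auto
  \<comment> \<open>Rounding \<open>1200 * T\<close> up costs less than 1, which one further copy of
    \<open>T\<close> absorbs; hence the constant 1201.\<close>
  then have T1: "T \<ge> 1" by simp
  have "real t \<ge> 1200 * T" unfolding t_def by linarith
  then have "lazy_walk_mixing_time n q \<le> enat t"
    by (intro lazy_walk_mixing_time_le[OF n q]) (simp add: T_def)
  then have "ereal_of_enat (lazy_walk_mixing_time n q) \<le> ereal (real t)"
    by (metis ereal_of_enat_le_iff ereal_of_enat_simps(1))
  also have "real t \<le> 1201 * T" using T1 unfolding t_def by linarith
  finally show "ereal_of_enat (lazy_walk_mixing_time n q) \<le> ereal (1201 * real n ^ 2 * ln (real q))"
    by (simp add: T_def mult.assoc)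
qed simp

end
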